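(* Let $r>0$ and let $f:\mathbb{R}\to\mathbb{R}$, $f(x)=a|x|^3+bx^2+cx+d$, with $a,b\ge 0$ (and $c,d\in\mathbb{R}$). Define $$p_1=p_1(x)=\frac{r+2b-\sqrt{(r+2b)^2-12a(rx-c)}}{6a},\qquad p_2=p_2(x)=\frac{-r-2b+\sqrt{(r+2b)^2+12a(rx-c)}}{6a}.$$ Then the proximal mapping and Moreau envelope of $f$ are $$P_rf(x)=\begin{cases}p_1,&\text{if }x<\frac cr,\\ p_2,&\text{if }x\ge\frac cr,\end{cases}$$ $$e_rf(x)=\begin{cases}-ap_1^3+bp_1^2+d-p_1(rx-c)+\frac r2(p_1^2+x^2),&\text{if }x<\frac cr,\\ ap_2^3+bp_2^2+d-p_2(rx-c)+\frac r2(p_2^2+x^2),&\text{if }x\ge\frac cr.\end{cases}$$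
   Context: For a function $f:\mathbb{R}\to\mathbb{R}\cup\{\infty\}$ and $r>0$, the Moreau envelope is $e_rf(x)=\inf_{y\in\mathbb{R}}\{f(y)+\frac r2(y-x)^2\}$ and the proximal mapping is $P_rf(x)=\operatorname{argmin}_{y\in\mathbb{R}}\{f(y)+\frac r2(y-x)^2\}$ (the set of points attaining the infimum, identified with its element when it is a singleton).
   Formalization: For a = 0 the quotients defining p_1 and p_2 have the undefined form 0/0; there they are read as their limits as a tends to 0 from the right. For a > 0 they are the stated formulas. *)

theory Defs
  imports "HOL-Analysis.Analysis"
begin

text \<open>
  Functions with values in \<open>\<real> \<union> {\<infinity>}\<close> are rendered as \<open>ereal\<close>-valued functions, so the
  infimum below always exists and is the extended-real one.
\<close>

definition moreau_envelope :: "real \<Rightarrow> (real \<Rightarrow> ereal) \<Rightarrow> real \<Rightarrow> ereal" where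
  "moreau_envelope r f x = (INF y. f y + ereal (r / 2 * (y - x)\<^sup>2))"

definition prox :: "real \<Rightarrow> (real \<Rightarrow> ereal) \<Rightarrow> real \<Rightarrow> real set" where
  "prox r f x = {y. f y + ereal (r / 2 * (y - x)\<^sup>2) = moreau_envelope r f x}"

definition p1_quotient :: "real \<Rightarrow> real \<Rightarrow> real \<Rightarrow> real \<Rightarrow> real \<Rightarrow> real" where
  "p1_quotient r a b c x =
     (r + 2 * b - sqrt ((r + 2 * b)\<^sup>2 - 12 * a * (r * x - c))) / (6 * a)"

definition p2_quotient :: "real \<Rightarrow> real \<Rightarrow> real \<Rightarrow> real \<Rightarrow> real \<Rightarrow> real" where
  "p2_quotient r a b c x =
     (- r - 2 * b + sqrt ((r + 2 * b)\<^sup>2 + 12 * a * (r * x - c))) / (6 * a)"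

text \<open>
  For \<open>a = 0\<close> both quotients have the undefined form \<open>0 / 0\<close> (which HOL would evaluate to \<open>0\<close>).
  They are read there as their limits for \<open>a\<close> tending to \<open>0\<close> from the right.
\<close>

definition p1 :: "real \<Rightarrow> real \<Rightarrow> real \<Rightarrow> real \<Rightarrow> real \<Rightarrow> real" where
  "p1 r a b c x =
     (if a = 0 then Lim (at_right 0) (\<lambda>\<alpha>. p1_quotient r \<alpha> b c x) else p1_quotient r a b c x)"

definition p2 :: "real \<Rightarrow> real \<Rightarrow> real \<Rightarrow> real \<Rightarrow> real \<Rightarrow> real" where
  "p2 r a b c x =
     (if a = 0 then Lim (at_right 0) (\<lambda>\<alpha>. p2_quotient r \<alpha> b c x) else p2_quotient r a b c x)"

end

theory Submission
  imports Defs
begin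

text \<open>
  Write \<open>m = r + 2 b\<close> and \<open>s = r x - c\<close>. A solution \<open>p\<close> of the stationarity equation
  \<open>3 a p \<bar>p\<bar> + m p = s\<close> is the unique minimiser of the proximal objective: after elimination of
  \<open>s\<close> the excess of the objective at \<open>y\<close> over its value at \<open>p\<close> is \<open>m / 2 * (y - p)\<^sup>2\<close> plus
  \<open>a\<close> times the tangent-line gap of the convex function \<open>\<bar>y\<bar>\<^sup>3\<close>. Rationalising the quadratic
  formula gives \<open>2 s / (m + sqrt (m\<^sup>2 + 12 a \<bar>s\<bar>))\<close> for the solution, which is also meaningful
  (and continuous) at \<open>a = 0\<close>.
\<close>

lemma abs_cube_above_tangent:
  fixes y p :: real
  shows "\<bar>p\<bar> ^ 3 + 3 * p * \<bar>p\<bar> * (y - p) \<le> \<bar>y\<bar> ^ 3"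
proof -
  have nonneg: "q ^ 3 + 3 * q * q * (z - q) \<le> \<bar>z\<bar> ^ 3" if "q \<ge> 0" for q z :: real
  proof (cases "z \<ge> 0")
    case True
    \<comment> \<open>For \<open>z \<ge> 0\<close> the gap
      \<open>z ^ 3 - 3 * q * q * z + 2 * q ^ 3\<close> has the double root \<open>q\<close> and
      factors as this product.\<close>
    have "(z - q)\<^sup>2 * (z + 2 * q) \<ge> 0"
      using True that by simp
    with True show ?thesis
      by (simp add: power2_eq_square power3_eq_cube algebra_simps)
  next
    case False
    have "3 * q * q * z \<le> 0"
      using False that by (simp add: mult_nonneg_nonpos)
    moreover have "q ^ 3 \<ge> 0" "\<bar>z\<bar> ^ 3 \<ge> 0"
      using that by simp_all
    ultimately show ?thesis
      by (simp add: power3_eq_cube algebra_simps)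
  qed
  show ?thesis
  proof (cases "p \<ge> 0")
    case True
    then show ?thesis using nonneg[of p y] by simp
  next
    case False
    \<comment> \<open>Both sides are invariant under changing the signs of \<open>p\<close> and
      \<open>y\<close> together.\<close>
    then show ?thesis using nonneg[of "- p" "- y"] by (simp add: algebra_simps)
  qed
qed

lemma prox_moreau_unique_minimizer:
  fixes f :: "real \<Rightarrow> real"
  assumes "\<And>y. y \<noteq> p \<Longrightarrow> f p + r / 2 * (p - x)\<^sup>2 < f y + r / 2 * (y - x)\<^sup>2"
  shows "prox r (\<lambda>y. ereal (f y)) x = {p}"
    and "moreau_envelope r (\<lambda>y. ereal (f y)) x = ereal (f p + r / 2 * (p - x)\<^sup>2)"
proof -
  show env: "moreau_envelope r (\<lambda>y. ereal (f y)) x = ereal (f p + r / 2 * (p - x)\<^sup>2)"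
    unfolding moreau_envelope_def
  proof (rule antisym)
    show "(INF y. ereal (f y) + ereal (r / 2 * (y - x)\<^sup>2)) \<le> ereal (f p + r / 2 * (p - x)\<^sup>2)"
      by (rule INF_lower2[of p]) simp_all
    show "ereal (f p + r / 2 * (p - x)\<^sup>2) \<le> (INF y. ereal (f y) + ereal (r / 2 * (y - x)\<^sup>2))"
      by (rule INF_greatest) (metis assms ereal_less_eq(3) less_imp_le order_refl plus_ereal.simps(1))
  qed
  show "prox r (\<lambda>y. ereal (f y)) x = {p}"
    unfolding prox_def env using assms by (force simp: less_le)
qed

lemma cubic_objective_unique_minimizer:
  fixes r a b c d x p y :: real
  defines "F \<equiv> \<lambda>z. a * \<bar>z\<bar> ^ 3 + b * z\<^sup>2 + c * z + d + r / 2 * (z - x)\<^sup>2"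
  assumes "r > 0" "a \<ge> 0" "b \<ge> 0"
    and stat: "3 * a * p * \<bar>p\<bar> + (r + 2 * b) * p = r * x - c"
    and "y \<noteq> p"
  shows "F p < F y"
proof -
  \<comment> \<open>Substituting for \<open>c\<close> turns the excess over \<open>F p\<close> into
    a polynomial identity in which the absolute values can be treated as free symbols.\<close>
  have c: "c = r * x - 3 * a * p * \<bar>p\<bar> - (r + 2 * b) * p"
    using stat by simp
  have "F y - F p = a * (\<bar>y\<bar> ^ 3 - (\<bar>p\<bar> ^ 3 + 3 * p * \<bar>p\<bar> * (y - p))) + (r / 2 + b) * (y - p)\<^sup>2"
    unfolding F_def c by (simp add: power2_eq_square field_simps)
  moreover have "a * (\<bar>y\<bar> ^ 3 - (\<bar>p\<bar> ^ 3 + 3 * p * \<bar>p\<bar> * (y - p))) \<ge> 0"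
    using abs_cube_above_tangent[of p y] \<open>a \<ge> 0\<close> by simp
  \<comment> \<open>Strictness comes from the quadratic term alone, so \<open>a = 0\<close> is
    covered too.\<close>
  moreover have "(r / 2 + b) * (y - p)\<^sup>2 > 0"
    using assms by simp
  ultimately show ?thesis by linarith
qed

text \<open>Meant for \<open>s \<ge> 0\<close>, as the magnitude of the minimiser; its sign is
  supplied separately. For \<open>m > 0\<close> the value at \<open>a = 0\<close> is
  \<open>s / m\<close>.\<close>

definition rationalized_root :: "real \<Rightarrow> real \<Rightarrow> real \<Rightarrow> real" where
  "rationalized_root m a s = 2 * s / (m + sqrt (m\<^sup>2 + 12 * a * s))"

text \<open>With \<open>w\<close> the square root, \<open>(w - m) * (w + m) = 12 * a * s\<close>, so
  the factor \<open>6 * a\<close> cancels.\<close>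

lemma rationalized_root_eq:
  assumes "m > 0" "a > 0" "s \<ge> 0"
  shows "(- m + sqrt (m\<^sup>2 + 12 * a * s)) / (6 * a) = rationalized_root m a s"
proof -
  define w where "w = sqrt (m\<^sup>2 + 12 * a * s)"
  have "w \<ge> 0" "w * w = m\<^sup>2 + 12 * a * s"
    using assms by (simp_all add: w_def)
  moreover have "m + w \<noteq> 0"
    using \<open>w \<ge> 0\<close> assms by simp
  ultimately show ?thesis
    using assms unfolding rationalized_root_def w_def[symmetric]
    by (simp add: field_simps power2_eq_square)
qed

lemma rationalized_root_solves:
  assumes "m > 0" "a \<ge> 0" "s \<ge> 0"
  defines "q \<equiv> rationalized_root m a s"
  shows "3 * a * q\<^sup>2 + m * q = s" and "q \<ge> 0"
proof -
  define w where "w = sqrt (m\<^sup>2 + 12 * a * s)"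
  have w: "w \<ge> 0" "w * w = m\<^sup>2 + 12 * a * s"
    using assms by (simp_all add: w_def)
  have q: "q = 2 * s / (m + w)"
    unfolding q_def rationalized_root_def w_def ..
  have pos: "m + w > 0" using w assms by simp
  then show "q \<ge> 0" using assms(3) by (simp add: q)
  \<comment> \<open>This is the quadratic equation multiplied by \<open>(m + w)\<^sup>2\<close>,
    using \<open>12 * a * s = w * w - m\<^sup>2\<close>. No division by \<open>a\<close> occurs, so
    \<open>a = 0\<close> is included.\<close>
  have "3 * a * (2 * s)\<^sup>2 + m * (2 * s) * (m + w) = s * (m + w)\<^sup>2"
    using w(2) by algebra
  then have "s = (3 * a * (2 * s)\<^sup>2 + m * (2 * s) * (m + w)) / (m + w)\<^sup>2"
    using pos by simp
  also have "\<dots> = 3 * a * q\<^sup>2 + m * q"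
    using pos by (simp add: q power_divide add_divide_distrib) (simp add: power2_eq_square)
  finally show "3 * a * q\<^sup>2 + m * q = s" ..
qed

text \<open>Evaluates the limits that define \<open>p1\<close> and \<open>p2\<close> at
  \<open>a = 0\<close>: the denominator tends to \<open>2 * m\<close>, which is positive.\<close>

lemma tendsto_rationalized_root:
  assumes "m > 0"
  shows "((\<lambda>\<alpha>. rationalized_root m \<alpha> s) \<longlongrightarrow> rationalized_root m 0 s) (at_right 0)"
  unfolding rationalized_root_def using assms by (intro tendsto_intros) simp

lemma p2_eq:
  assumes "r > 0" "a \<ge> 0" "b \<ge> 0" and s: "r * x - c \<ge> 0"
  shows "p2 r a b c x = rationalized_root (r + 2 * b) a (r * x - c)"
proof -
  have quot: "p2_quotient r \<alpha> b c x = rationalized_root (r + 2 * b) \<alpha> (r * x - c)" if "\<alpha> > 0" for \<alpha>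
    using rationalized_root_eq[of "r + 2 * b" \<alpha> "r * x - c"] assms that
    by (simp add: p2_quotient_def)
  have "((\<lambda>\<alpha>. p2_quotient r \<alpha> b c x) \<longlongrightarrow> rationalized_root (r + 2 * b) 0 (r * x - c)) (at_right 0)"
    using tendsto_rationalized_root[of "r + 2 * b" "r * x - c"] assms
    by (subst filterlim_cong[OF refl refl eventually_mono[OF eventually_at_right_less]])
      (simp_all add: quot)
  then show ?thesis
    using quot assms by (auto simp: p2_def intro!: tendsto_Lim)
qed

text \<open>Mirror image of the \<open>p2\<close> case: replacing \<open>s\<close> by
  \<open>- s\<close> negates the root.\<close>

lemma p1_eq:
  assumes "r > 0" "a \<ge> 0" "b \<ge> 0" and s: "r * x - c \<le> 0"
  shows "p1 r a b c x = - rationalized_root (r + 2 * b) a (c - r * x)"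
proof -
  have quot: "p1_quotient r \<alpha> b c x = - rationalized_root (r + 2 * b) \<alpha> (c - r * x)" if "\<alpha> > 0" for \<alpha>
  proof -
    have "(r + 2 * b)\<^sup>2 - 12 * \<alpha> * (r * x - c) = (r + 2 * b)\<^sup>2 + 12 * \<alpha> * (c - r * x)"
      by (simp add: algebra_simps)
    then show ?thesis
      using rationalized_root_eq[of "r + 2 * b" \<alpha> "c - r * x", symmetric] assms that
      by (simp add: p1_quotient_def minus_divide_left)
  qed
  have "((\<lambda>\<alpha>. p1_quotient r \<alpha> b c x) \<longlongrightarrow> - rationalized_root (r + 2 * b) 0 (c - r * x)) (at_right 0)"
    using tendsto_minus[OF tendsto_rationalized_root[of "r + 2 * b" "c - r * x"]] assms
    by (subst filterlim_cong[OF refl refl eventually_mono[OF eventually_at_right_less]])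
      (simp_all add: quot)
  then show ?thesis
    using quot assms by (auto simp: p1_def intro!: tendsto_Lim)
qed

theorem theorem4p9:
  fixes r a b c d :: real and f :: "real \<Rightarrow> real"
  assumes "r > 0" and "a \<ge> 0" and "b \<ge> 0"
    and "\<And>x. f x = a * \<bar>x\<bar> ^ 3 + b * x\<^sup>2 + c * x + d"
  shows "\<forall>x::real.
      (let p\<^sub>1 = p1 r a b c x; p\<^sub>2 = p2 r a b c x in
        prox r (\<lambda>y. ereal (f y)) x = {if x < c / r then p\<^sub>1 else p\<^sub>2} \<and>
        moreau_envelope r (\<lambda>y. ereal (f y)) x =
          ereal (if x < c / r
                 then - a * p\<^sub>1 ^ 3 + b * p\<^sub>1\<^sup>2 + d - p\<^sub>1 * (r * x - c) + r / 2 * (p\<^sub>1\<^sup>2 + x\<^sup>2)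
                 else a * p\<^sub>2 ^ 3 + b * p\<^sub>2\<^sup>2 + d - p\<^sub>2 * (r * x - c) + r / 2 * (p\<^sub>2\<^sup>2 + x\<^sup>2)))"
proof (rule allI, unfold Let_def)
  fix x :: real
  have m: "r + 2 * b > 0" using assms(1,3) by simp
  define p where "p = (if x < c / r then p1 r a b c x else p2 r a b c x)"
  \<comment> \<open>Stationarity yields minimality; the sign of \<open>p\<close> is recorded to
    resolve \<open>\<bar>p\<bar> ^ 3\<close> in the envelope formula.\<close>
  have sign_stat: "(if x < c / r then p \<le> 0 else p \<ge> 0) \<and>
      3 * a * p * \<bar>p\<bar> + (r + 2 * b) * p = r * x - c"
  proof (cases "x < c / r")
    case True
    then have s: "r * x - c \<le> 0" using assms(1) by (simp add: field_simps)
    show ?thesis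
      using True s rationalized_root_solves[OF m assms(2), of "c - r * x"]
      by (simp add: p_def p1_eq[OF assms(1-3) s] power2_eq_square algebra_simps)
  next
    case False
    then have s: "r * x - c \<ge> 0" using assms(1) by (simp add: field_simps)
    show ?thesis
      using False s rationalized_root_solves[OF m assms(2), of "r * x - c"]
      by (simp add: p_def p2_eq[OF assms(1-3) s] power2_eq_square algebra_simps)
  qed
  have "f p + r / 2 * (p - x)\<^sup>2 < f y + r / 2 * (y - x)\<^sup>2" if "y \<noteq> p" for y
    using cubic_objective_unique_minimizer[OF assms(1-3) conjunct2[OF sign_stat] that]
    by (simp add: assms(4))
  note min = prox_moreau_unique_minimizer[of p f r x, OF this]
  \<comment> \<open>The cross term \<open>- r * p * x\<close> of the square joins
    \<open>c * p\<close> to form \<open>- p * (r * x - c)\<close>.\<close>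
  have "f p + r / 2 * (p - x)\<^sup>2 =
      (if x < c / r
       then - a * p ^ 3 + b * p\<^sup>2 + d - p * (r * x - c) + r / 2 * (p\<^sup>2 + x\<^sup>2)
       else a * p ^ 3 + b * p\<^sup>2 + d - p * (r * x - c) + r / 2 * (p\<^sup>2 + x\<^sup>2))"
    using sign_stat
    by (auto simp: assms(4) power2_eq_square power3_eq_cube field_simps split: if_splits)
  with min show "prox r (\<lambda>y. ereal (f y)) x = {if x < c / r then p1 r a b c x else p2 r a b c x} \<and>
      moreau_envelope r (\<lambda>y. ereal (f y)) x =
        ereal (if x < c / r
               then - a * p1 r a b c x ^ 3 + b * (p1 r a b c x)\<^sup>2 + d - p1 r a b c x * (r * x - c)
                 + r / 2 * ((p1 r a b c x)\<^sup>2 + x\<^sup>2)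
               else a * p2 r a b c x ^ 3 + b * (p2 r a b c x)\<^sup>2 + d - p2 r a b c x * (r * x - c)
                 + r / 2 * ((p2 r a b c x)\<^sup>2 + x\<^sup>2))"
    by (simp add: p_def split: if_splits)
qed

end
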